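(* Let $n,p,m\in\mathbb N$, let $\lambda\ge\mu\ge 0$, $l\ge 0$, $\delta\ge0$ be real, let $-1\le A<B\le 1$, $0<B\le 1$, and let $0\le\sigma_j<p$ for $j=1,\dots,m$. Let $f_j(z)=z^p-\sum_{k=n+p}^\infty|a_{k,j}|z^k$ be in the class $\widetilde{\mathcal P}_{\lambda,\mu,l}^{\delta}(A,B;\sigma_j,p)$ for $j=1,\dots,m$. Put $$\chi:=p-\frac{m(B-A)(p-\sigma^* )^2}{(n+p)(1+B)\Phi_p^{n+p}(\delta,\lambda,\mu,l)},\qquad \sigma^*:=\min\{\sigma_1,\sigma_2,\dots,\sigma_m\},$$ and assume $\chi\ge0$. Then the function $$h(z)=z^p-\sum_{k=n+p}^\infty\left(\sum_{j=1}^m|a_{k,j}|^2\right)z^k$$ belongs to the class $\widetilde{\mathcal P}_{\lambda,\mu,l}^{\delta}(A,B;\chi,p)$. The result is sharp for the functions $$f_j(z)=z^p-\frac{(B-A)(p-\sigma_j)}{(n+p)(1+B)\Phi_p^{n+p}(\delta,\lambda,\mu,l)}z^{p+n}\qquad(j=1,\dots,m),$$ i.e. for these functions $\chi$ cannot be replaced by any larger number.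
   Context: $\mathbb N=\{1,2,3,\dots\}$ and $\mathcal U=\{z\in\mathbb C:|z|<1\}$. $\mathcal A(n,p)$ is the class of functions $f(z)=z^p+\sum_{k=n+p}^\infty a_kz^k$ that are analytic and $p$-valent in $\mathcal U$ ($p$-valent: no value is taken more than $p$ times in $\mathcal U$, counted with multiplicity, and some value is taken exactly $p$ times). For $k\ge n+p$ put $$\Phi_p^k(\delta,\lambda,\mu,l)=\left[\frac{(k-p)(\lambda\mu k+\lambda-\mu)+p+l}{p+l}\right]^{\delta},\qquad \mathcal J_p^\delta(\lambda,\mu,l)f(z)=z^p+\sum_{k=n+p}^\infty\Phi_p^k(\delta,\lambda,\mu,l)\,a_kz^k .$$ For $F,G$ analytic in $\mathcal U$, $F\prec G$ (subordination) means $F(z)=G(w(z))$ in $\mathcal U$ for some analytic $w:\mathcal U\to\mathbb C$ with $w(0)=0$, $|w(z)|<1$. For $0\le\sigma<p$, the class $\mathcal P_{\lambda,\mu,l}^{\delta}(A,B;\sigma,p)$ consists of all $f\in\mathcal A(n,p)$ with $$\frac1{p-\sigma}\left(\frac{[\mathcal J_p^\delta(\lambda,\mu,l)f(z)]'}{z^{p-1}}-\sigma\right)\prec\frac{1+Az}{1+Bz}\quad(z\in\mathcal U)$$ (the quotient by $z^{p-1}$ being extended analytically to $z=0$), and $\widetilde{\mathcal P}_{\lambda,\mu,l}^{\delta}(A,B;\sigma,p)$ is the subclass of those $f$ of the form $f(z)=z^p-\sum_{k=n+p}^\infty|a_k|z^k$.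
   Formalization: Sharpness is stated only when all σ_j equal σ*: otherwise it is false, e.g. p=n=1, m=2, δ=0, A=0, B=1, σ=(0,1/2) gives χ=1/2, yet h lies in the class of order 11/16. "Larger number" ranges over orders below p. *)

theory Defs
  imports "HOL-Complex_Analysis.Complex_Analysis"
begin

text \<open>The open unit disc is \<^term>\<open>ball (0::complex) 1\<close>.\<close>

text \<open>
  The expansion \<open>f z = z^p + (\<Sum>k\<ge>n+p. a k * z^k)\<close> on the unit disc, convergence included.
  Only the values \<open>a k\<close> with \<open>k \<ge> n + p\<close> matter; \<open>i\<close> runs over \<open>k - (n + p)\<close>.
\<close>
definition has_coeffs :: "nat \<Rightarrow> nat \<Rightarrow> (nat \<Rightarrow> complex) \<Rightarrow> (complex \<Rightarrow> complex) \<Rightarrow> bool" where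
  "has_coeffs n p a f \<longleftrightarrow>
     (\<forall>z\<in>ball 0 1. (\<lambda>i. a (n + p + i) * z ^ (n + p + i)) sums (f z - z ^ p))"

definition preimages :: "(complex \<Rightarrow> complex) \<Rightarrow> complex \<Rightarrow> complex set" where
  "preimages f v = {z \<in> ball 0 1. f z = v}"

text \<open>
  The number of times \<open>f\<close> takes the value \<open>v\<close> in the disc, counted with multiplicity.
  It is meaningful only when \<^term>\<open>preimages f v\<close> is finite (an infinite sum is 0 by convention),
  which is therefore required explicitly below.
\<close>
definition times_taken :: "(complex \<Rightarrow> complex) \<Rightarrow> complex \<Rightarrow> int" where
  "times_taken f v = (\<Sum>z\<in>preimages f v. zorder (\<lambda>x. f x - v) z)"

definition p_valent :: "nat \<Rightarrow> (complex \<Rightarrow> complex) \<Rightarrow> bool" where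
  "p_valent p f \<longleftrightarrow>
     (\<forall>v. finite (preimages f v) \<and> times_taken f v \<le> int p) \<and>
     (\<exists>v. times_taken f v = int p)"

definition class_A :: "nat \<Rightarrow> nat \<Rightarrow> (complex \<Rightarrow> complex) set" where
  "class_A n p =
     {f. f holomorphic_on ball 0 1 \<and> (\<exists>a. has_coeffs n p a f) \<and> p_valent p f}"

definition Phi :: "nat \<Rightarrow> real \<Rightarrow> real \<Rightarrow> real \<Rightarrow> real \<Rightarrow> nat \<Rightarrow> real" where
  "Phi p \<delta> lam \<mu> l k =
     (((real k - real p) * (lam * \<mu> * real k + lam - \<mu>) + real p + l) / (real p + l)) powr \<delta>"

text \<open>The coefficients \<open>a k\<close> of \<open>f\<close> are recovered as its Taylor coefficients at 0.\<close>
definition J :: "nat \<Rightarrow> nat \<Rightarrow> real \<Rightarrow> real \<Rightarrow> real \<Rightarrow> real \<Rightarrow> (complex \<Rightarrow> complex) \<Rightarrow> complex \<Rightarrow> complex" where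
  "J n p \<delta> lam \<mu> l f z =
     z ^ p + (\<Sum>i. of_real (Phi p \<delta> lam \<mu> l (n + p + i)) *
                    fps_nth (fps_expansion f 0) (n + p + i) * z ^ (n + p + i))"

definition subordinate :: "(complex \<Rightarrow> complex) \<Rightarrow> (complex \<Rightarrow> complex) \<Rightarrow> bool" where
  "subordinate F G \<longleftrightarrow>
     (\<exists>w. w holomorphic_on ball 0 1 \<and> w 0 = 0 \<and> (\<forall>z\<in>ball 0 1. norm (w z) < 1) \<and>
          (\<forall>z\<in>ball 0 1. F z = G (w z)))"

text \<open>\<^const>\<open>remove_sings\<close> extends the quotient by \<open>z^(p-1)\<close> analytically to 0.\<close>
definition class_P ::
  "nat \<Rightarrow> nat \<Rightarrow> real \<Rightarrow> real \<Rightarrow> real \<Rightarrow> real \<Rightarrow> real \<Rightarrow> real \<Rightarrow> real \<Rightarrow> (complex \<Rightarrow> complex) set" where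
  "class_P n p \<delta> lam \<mu> l A B \<sigma> =
     {f \<in> class_A n p.
        subordinate
          (\<lambda>z. 1 / of_real (real p - \<sigma>) *
               (remove_sings (\<lambda>x. deriv (J n p \<delta> lam \<mu> l f) x / x ^ (p - 1)) z - of_real \<sigma>))
          (\<lambda>z. (1 + of_real A * z) / (1 + of_real B * z))}"

definition class_P_neg ::
  "nat \<Rightarrow> nat \<Rightarrow> real \<Rightarrow> real \<Rightarrow> real \<Rightarrow> real \<Rightarrow> real \<Rightarrow> real \<Rightarrow> real \<Rightarrow> (complex \<Rightarrow> complex) set" where
  "class_P_neg n p \<delta> lam \<mu> l A B \<sigma> =
     {f \<in> class_P n p \<delta> lam \<mu> l A B \<sigma>.
        \<exists>a :: nat \<Rightarrow> complex. has_coeffs n p (\<lambda>k. - of_real (norm (a k))) f}"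

text \<open>\<open>a k j\<close> is the \<open>k\<close>-th coefficient belonging to the \<open>j\<close>-th function.\<close>
definition square_sum_fun :: "nat \<Rightarrow> nat \<Rightarrow> nat \<Rightarrow> (nat \<Rightarrow> nat \<Rightarrow> complex) \<Rightarrow> complex \<Rightarrow> complex" where
  "square_sum_fun n p m a z =
     z ^ p - (\<Sum>i. of_real (\<Sum>j=1..m. (norm (a (n + p + i) j))\<^sup>2) * z ^ (n + p + i))"

definition extremal_coeff ::
  "nat \<Rightarrow> nat \<Rightarrow> real \<Rightarrow> real \<Rightarrow> real \<Rightarrow> real \<Rightarrow> real \<Rightarrow> real \<Rightarrow> real \<Rightarrow> real" where
  "extremal_coeff n p \<delta> lam \<mu> l A B \<sigma> =
     (B - A) * (real p - \<sigma>) / (real (n + p) * (1 + B) * Phi p \<delta> lam \<mu> l (n + p))"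

end

theory Submission
  imports Defs
begin

text \<open>
  Everything reduces to one coefficient inequality. Write \<open>f z = z^p - (\<Sum>k\<ge>n+p. c k * z^k)\<close>
  with \<open>c k \<ge> 0\<close> and let \<open>weight k = k * \<Phi> k\<close>. For \<open>0 \<le> \<sigma> < p\<close>, \<open>f\<close> lies in the class of order
  \<open>\<sigma>\<close> if and only if \<open>(1 + B) * (\<Sum>k. weight k * c k) \<le> (B - A) * (p - \<sigma>)\<close>. Indeed the function
  that is required to be subordinate to \<open>(1 + A z) / (1 + B z)\<close> is \<open>1 - Q z\<close>, where
  \<open>Q z = (\<Sum>k. weight k * c k * z^(k-p)) / (p - \<sigma>)\<close>; solving \<open>1 - Q = (1 + A w) / (1 + B w)\<close>
  gives \<open>w = Q / (B - A - B Q)\<close>. As \<open>Q\<close> has nonnegative coefficients, its modulus is largest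
  on the positive radius, so that \<open>norm w < 1\<close> throughout the disc amounts to the real
  inequality \<open>(1 + B) * Q r < B - A\<close> for \<open>r < 1\<close>, and \<open>r\<close> tends to 1. The two directions are
  \<open>class_P_neg_imp_coeff_bound\<close> and \<open>class_P_negI\<close>.

  For the second direction \<open>p\<close>-valence has to be proved as well. Since \<open>\<Phi> k \<ge> 1\<close> and
  \<open>B - A \<le> 1 + B\<close>, the inequality implies \<open>(\<Sum>k. k * c k) \<le> p\<close>, and this makes \<open>f\<close> starlike:
  with \<open>f z = z^p * g z\<close> it gives \<open>norm (z * g' z) < p * norm (g z)\<close>, that is
  \<open>norm (z * f' z / f z - p) < p\<close>. In the coordinate \<open>\<zeta> = ln z\<close>, which ranges over a left
  half-plane, \<open>ln f\<close> then has a derivative with positive real part on a convex set and is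
  injective. Hence the \<open>p\<close>-th root \<open>z * (g z)^(1/p)\<close> of \<open>f\<close> is injective on the disc, and \<open>f\<close>
  takes no value more than \<open>p\<close> times (\<open>starlike_imp_p_valent\<close>).

  Given the characterization, the theorem is an estimate of sums of squares. Each member
  satisfies \<open>(\<Sum>k. weight k * c k) \<le> M\<close> with \<open>M = (B - A) * (p - \<sigma>s) / (1 + B)\<close>, and \<open>weight\<close>
  is smallest at \<open>n + p\<close>, so \<open>(\<Sum>k. weight k * (c k)\<^sup>2) \<le> M\<^sup>2 / weight (n + p)\<close>. Summing over
  the \<open>m\<close> functions yields the bound that defines \<open>\<chi>\<close>, and \<open>\<chi> \<ge> 0\<close> makes the resulting
  function \<open>p\<close>-valent. All of these estimates are equalities when \<open>c\<close> is concentrated at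
  \<open>n + p\<close> with the largest admissible value and all \<open>\<sigma> j\<close> agree, hence the sharpness.
\<close>

section \<open>Power series on the unit disc\<close>

text \<open>
  A tail \<open>z^N * (c 0 + c 1 * z + \<dots>)\<close> is an ordinary power series whose first \<open>N\<close> coefficients vanish;
  this makes the library results on power series applicable to the tails that occur below.
\<close>
lemma sums_shift_index:
  fixes c :: "nat \<Rightarrow> complex"
  shows "(\<lambda>i. c i * z ^ (N + i)) sums s \<longleftrightarrow> (\<lambda>k. (if k < N then 0 else c (k - N)) * z ^ k) sums s"
proof -
  have "(\<lambda>i. c i * z ^ (N + i)) = (\<lambda>i. (if i + N < N then 0 else c (i + N - N)) * z ^ (i + N))"
    by (auto simp: add.commute)
  then show ?thesis
    using sums_iff_shift[of "\<lambda>k. (if k < N then 0 else c (k - N)) * z ^ k" N s] by simp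
qed

lemma shifted_power_series_holomorphic:
  fixes c :: "nat \<Rightarrow> complex"
  assumes "\<And>z. z \<in> ball 0 1 \<Longrightarrow> (\<lambda>i. c i * z ^ (N + i)) sums S z"
  shows "S holomorphic_on ball 0 1"
  by (rule power_series_holomorphic[where a = "\<lambda>k. if k < N then 0 else c (k - N)"])
     (use assms in \<open>simp add: sums_shift_index\<close>)

text \<open>
  The Euler operator \<open>z * d/dz\<close> multiplies the \<open>k\<close>-th coefficient by \<open>k\<close> without shifting exponents, so
  it is used here in place of the derivative.
\<close>
lemma shifted_power_series_deriv:
  fixes c :: "nat \<Rightarrow> complex"
  assumes "\<And>z. z \<in> ball 0 1 \<Longrightarrow> (\<lambda>i. c i * z ^ (N + i)) sums S z"
    and z: "z \<in> ball 0 1"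
  shows "(\<lambda>i. of_nat (N + i) * c i * z ^ (N + i)) sums (z * deriv S z)"
proof -
  define e where "e k = (if k < N then 0 else c (k - N))" for k
  have e: "(\<lambda>k. e k * z ^ k) sums S z" if "norm z < 1" for z
    using assms(1)[of z] that by (simp add: sums_shift_index e_def)
  have "(S has_field_derivative deriv S z) (at z)"
    using shifted_power_series_holomorphic[of c N S, OF assms(1)] z
    by (intro holomorphic_derivI[of S "ball 0 1"]) auto
  from termdiffs_sums_strong[of 1 e S, OF e this]
  have "(\<lambda>k. z * (diffs e k * z ^ k)) sums (z * deriv S z)"
    using z by (intro sums_mult) auto
  then have "(\<lambda>k. of_nat (Suc k) * e (Suc k) * z ^ Suc k) sums (z * deriv S z)"
    by (simp add: diffs_def mult_ac)
  then have "(\<lambda>k. of_nat k * e k * z ^ k) sums (z * deriv S z)"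
    by (subst (asm) sums_Suc_iff) simp
  then have "(\<lambda>k. (if k < N then 0 else of_nat (N + (k - N)) * c (k - N)) * z ^ k)
      sums (z * deriv S z)"
    by (rule sums_cong[THEN iffD1, rotated]) (auto simp: e_def)
  then show ?thesis
    by (simp only: sums_shift_index[of "\<lambda>i. of_nat (N + i) * c i" z N])
qed

lemma power_series_fps_nth:
  fixes e :: "nat \<Rightarrow> complex"
  assumes e: "\<And>z. z \<in> ball 0 1 \<Longrightarrow> (\<lambda>k. e k * z ^ k) sums f z"
  shows "fps_nth (fps_expansion f 0) k = e k"
proof -
  have "conv_radius e \<ge> 1"
  proof (rule conv_radius_geI_ex')
    fix r :: real assume "0 < r" "ereal r < 1"
    then show "summable (\<lambda>n. e n * of_real r ^ n)"
      using e[of "of_real r"] by (auto simp: sums_iff)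
  qed
  then have "fps_conv_radius (Abs_fps e) > 0"
    unfolding fps_conv_radius_def fps_nth_Abs_fps
    by (rule less_le_trans[rotated]) simp
  moreover have "\<forall>\<^sub>F z in nhds 0. eval_fps (Abs_fps e) z = f z"
    using eventually_nhds_in_open[of "ball 0 1" "0::complex"]
    by (auto elim!: eventually_mono simp: eval_fps_def intro!: sums_unique[symmetric] e)
  ultimately have "f has_fps_expansion Abs_fps e"
    unfolding has_fps_expansion_def by blast
  then have "fps_expansion f 0 = Abs_fps e"
    by (rule fps_expansion_eqI)
  then show ?thesis by simp
qed

text \<open>
  Since \<open>n \<ge> 1\<close>, the leading term \<open>z^p\<close> does not collide with the tail, which therefore consists of
  the Taylor coefficients from which \<^const>\<open>J\<close> is built.
\<close>
lemma has_coeffs_imp_fps_nth: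
  assumes "n \<ge> 1" and a: "has_coeffs n p a f"
  shows "fps_nth (fps_expansion f 0) (n + p + i) = a (n + p + i)"
proof -
  define e where "e k = (if k = p then 1 else if k < n + p then 0 else a k)" for k
  have "(\<lambda>k. e k * z ^ k) sums f z" if z: "z \<in> ball 0 1" for z
  proof -
    have "(\<lambda>i. a (n + p + i) * z ^ (n + p + i)) sums (f z - z ^ p)"
      using a z by (simp add: has_coeffs_def)
    moreover have "(\<lambda>i. a (n + p + i) * z ^ (n + p + i)) =
        (\<lambda>i. e (i + (n + p)) * z ^ (i + (n + p)))"
      using \<open>n \<ge> 1\<close> by (auto simp: e_def add_ac)
    ultimately have "(\<lambda>k. e k * z ^ k) sums (f z - z ^ p + (\<Sum>k<n + p. e k * z ^ k))"
      by (simp only: sums_iff_shift[of "\<lambda>k. e k * z ^ k"])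
    also have "(\<Sum>k<n + p. e k * z ^ k) = (\<Sum>k<n + p. if k = p then z ^ p else 0)"
      by (rule sum.cong) (auto simp: e_def)
    also have "\<dots> = z ^ p"
      using \<open>n \<ge> 1\<close> by simp
    finally show ?thesis by simp
  qed
  then have "fps_nth (fps_expansion f 0) (n + p + i) = e (n + p + i)"
    by (rule power_series_fps_nth)
  then show ?thesis
    using \<open>n \<ge> 1\<close> by (simp add: e_def)
qed

lemma has_coeffs_holomorphic:
  assumes "has_coeffs n p a f"
  shows "f holomorphic_on ball 0 1"
proof -
  have "(\<lambda>z. f z - z ^ p) holomorphic_on ball 0 1"
    by (rule shifted_power_series_holomorphic[of "\<lambda>i. a (n + p + i)" "n + p"])
       (use assms in \<open>simp add: has_coeffs_def\<close>)
  then have "(\<lambda>z. (f z - z ^ p) + z ^ p) holomorphic_on ball 0 1"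
    by (intro holomorphic_on_add holomorphic_on_power holomorphic_on_ident)
  then show ?thesis by simp
qed

text \<open>
  Because every exponent is at least 1, the bound carries a factor \<open>norm z < 1\<close>. This factor turns the
  non-strict coefficient conditions into the strict inequalities that hold inside the open disc.
\<close>
lemma dominated_power_series:
  fixes u :: "nat \<Rightarrow> real"
  assumes "\<And>i. u i \<ge> 0" "summable u" "N \<ge> 1" "norm z < 1"
  shows "summable (\<lambda>i. of_real (u i) * z ^ (N + i) :: complex)"
    and "norm (\<Sum>i. of_real (u i) * z ^ (N + i) :: complex) \<le> norm z * suminf u"
proof -
  have bd: "norm (of_real (u i) * z ^ (N + i) :: complex) \<le> norm z * u i" for i
  proof -
    have "norm z ^ (N + i) \<le> norm z ^ 1"
      using assms by (intro power_decreasing) auto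
    then show ?thesis
      using assms(1)[of i] mult_right_mono[of "norm z ^ (N + i)" "norm z" "u i"]
      by (simp add: norm_mult norm_power mult.commute)
  qed
  have s: "summable (\<lambda>i. norm z * u i)"
    using assms by (intro summable_mult)
  show "summable (\<lambda>i. of_real (u i) * z ^ (N + i) :: complex)"
    by (rule summable_comparison_test'[OF s bd])
  have "norm (\<Sum>i. of_real (u i) * z ^ (N + i) :: complex) \<le> (\<Sum>i. norm z * u i)"
    by (rule norm_suminf_le[OF bd s])
  then show "norm (\<Sum>i. of_real (u i) * z ^ (N + i) :: complex) \<le> norm z * suminf u"
    using assms by (simp add: suminf_mult)
qed

lemma has_coeffs_of_summable:
  fixes c :: "nat \<Rightarrow> real"
  assumes n: "n \<ge> 1" and c: "\<And>k. c k \<ge> 0" and s: "summable (\<lambda>i. c (n + p + i))"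
  shows "has_coeffs n p (\<lambda>k. - of_real (c k))
           (\<lambda>z. z ^ p - (\<Sum>i. of_real (c (n + p + i)) * z ^ (n + p + i)))"
  unfolding has_coeffs_def
proof
  fix z :: complex assume "z \<in> ball 0 1"
  then have "summable (\<lambda>i. of_real (c (n + p + i)) * z ^ (n + p + i))"
    using n c s by (intro dominated_power_series(1)) auto
  from sums_minus[OF summable_sums[OF this]]
  show "(\<lambda>i. - of_real (c (n + p + i)) * z ^ (n + p + i)) sums
      (z ^ p - (\<Sum>i. of_real (c (n + p + i)) * z ^ (n + p + i)) - z ^ p)"
    by simp
qed

lemma summable_powr_geometric:
  fixes r s :: real
  assumes "0 < r" "r < 1"
  shows "summable (\<lambda>k. real k powr s * r ^ k)"
proof (rule summable_comparison_test_bigo)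
  show "summable (\<lambda>k. norm (1 / real k ^ 2))"
    using inverse_power_summable[of 2, where 'a = real] by (simp add: divide_inverse)
  show "(\<lambda>k. real k powr s * r ^ k) \<in> O(\<lambda>k. 1 / real k ^ 2)"
    using assms by real_asymp
qed

text \<open>
  Multiplying the coefficients by factors of polynomial growth does not shrink the disc of convergence.
  Compare with the point \<open>r = (1 + norm z) / 2\<close>: by the inequality between arithmetic and geometric mean
  \<open>norm z \<le> r\<^sup>2\<close>, so one factor \<open>r^k\<close> keeps the coefficients bounded and the other one absorbs the growth.
\<close>
lemma summable_moderate_multiplier:
  fixes a :: "nat \<Rightarrow> complex" and w :: "nat \<Rightarrow> real"
  assumes a: "\<And>z. z \<in> ball 0 1 \<Longrightarrow> summable (\<lambda>k. a k * z ^ k)"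
    and w: "\<And>k. k \<ge> K \<Longrightarrow> 0 \<le> w k \<and> w k \<le> C * real k powr s"
    and z: "z \<in> ball 0 1"
  shows "summable (\<lambda>k. of_real (w k) * a k * z ^ k)"
proof -
  define r where "r = (1 + norm z) / 2"
  have "0 < r"
    unfolding r_def by (intro divide_pos_pos add_pos_nonneg) auto
  then have r: "0 < r" "r < 1" "norm z \<le> r * r"
    using z zero_le_power2[of "1 - norm z"]
    by (auto simp: r_def field_simps power2_eq_square)
  have "(\<lambda>k. a k * of_real r ^ k) \<longlonglongrightarrow> 0"
    using r by (intro summable_LIMSEQ_zero a) auto
  then obtain M where M: "\<And>k. norm (a k * of_real r ^ k) \<le> M"
    using convergentI Bseq_def convergent_imp_Bseq by metis
  have "summable (\<lambda>k. (C * M) * (real k powr s * r ^ k))"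
    using r by (intro summable_mult summable_powr_geometric)
  then show ?thesis
  proof (rule summable_comparison_test')
    fix k assume k: "k \<ge> K"
    have "norm (z ^ k) \<le> r ^ k * r ^ k"
      using r power_mono[of "norm z" "r * r" k] by (simp add: norm_power power_mult_distrib)
    then have "norm (a k * z ^ k) \<le> norm (a k) * (r ^ k * r ^ k)"
      by (simp add: norm_mult mult_left_mono)
    also have "\<dots> = norm (a k * of_real r ^ k) * r ^ k"
      using r by (simp add: norm_mult norm_power)
    also have "\<dots> \<le> M * r ^ k"
      using r by (intro mult_right_mono M) auto
    finally have *: "norm (a k * z ^ k) \<le> M * r ^ k" .
    have "norm (of_real (w k) * a k * z ^ k) = w k * norm (a k * z ^ k)"
      using w[OF k] by (simp add: norm_mult)
    also have "\<dots> \<le> (C * real k powr s) * (M * r ^ k)"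
      using w[OF k] * by (intro mult_mono) auto
    finally show "norm (of_real (w k) * a k * z ^ k) \<le> (C * M) * (real k powr s * r ^ k)"
      by (simp add: mult_ac)
  qed
qed

text \<open>
  For nonnegative coefficients a bound on \<open>(0, 1)\<close> passes to each partial sum as \<open>r\<close> tends to 1, and from
  there to the whole series at the boundary point 1.
\<close>
lemma nonneg_summable_at_1:
  fixes w :: "nat \<Rightarrow> real"
  assumes w: "\<And>i. w i \<ge> 0"
    and le: "\<And>r N. 0 < r \<Longrightarrow> r < 1 \<Longrightarrow> (\<Sum>i<N. w i * r ^ (n + i)) \<le> M"
  shows "summable w" and "suminf w \<le> M"
proof -
  have partial: "(\<Sum>i<N. w i) \<le> M" for N
  proof -
    have "((\<lambda>r. \<Sum>i<N. w i * r ^ (n + i)) \<longlongrightarrow> (\<Sum>i<N. w i * 1 ^ (n + i))) (at_left 1)"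
      by (intro tendsto_intros)
    moreover have "\<forall>\<^sub>F r in at_left (1::real). (\<Sum>i<N. w i * r ^ (n + i)) \<le> M"
      using eventually_at_left_real[OF zero_less_one] by eventually_elim (use le in auto)
    ultimately have "(\<Sum>i<N. w i * 1 ^ (n + i)) \<le> M"
      by (rule tendsto_upperbound) simp
    then show ?thesis by simp
  qed
  show "summable w"
    by (rule summableI_nonneg_bounded[OF w partial])
  then show "suminf w \<le> M"
    by (rule suminf_le_const[OF _ partial])
qed

section \<open>A criterion for \<open>p\<close>-valence\<close>

text \<open>
  The Noshiro--Warschawski criterion: along the segment from \<open>a\<close> to \<open>b\<close> the real part of
  \<open>f / (b - a)\<close> has derivative \<open>Re f' > 0\<close>, so it increases strictly and \<open>f a \<noteq> f b\<close>.
\<close>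
lemma inj_on_convex_Re_deriv_pos:
  fixes f :: "complex \<Rightarrow> complex"
  assumes "convex S"
    and f: "\<And>z. z \<in> S \<Longrightarrow> (f has_field_derivative f' z) (at z)"
    and pos: "\<And>z. z \<in> S \<Longrightarrow> Re (f' z) > 0"
  shows "inj_on f S"
proof (rule inj_onI, rule ccontr)
  fix a b assume ab: "a \<in> S" "b \<in> S" "f a = f b" "a \<noteq> b"
  define \<phi> where "\<phi> t = Re (f (a + of_real t * (b - a)) / (b - a))" for t :: real
  have "\<phi> 0 < \<phi> 1"
  proof (rule DERIV_pos_imp_increasing[of 0 1 \<phi>])
    fix t :: real assume t: "0 \<le> t" "t \<le> 1"
    define z where "z = a + of_real t * (b - a)"
    have "z = (1 - t) *\<^sub>R a + t *\<^sub>R b"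
      by (simp add: z_def scaleR_conv_of_real algebra_simps)
    then have zS: "z \<in> S"
      using \<open>convex S\<close> ab t by (simp add: convexD_alt)
    have "((\<lambda>s. f (a + s * (b - a)) / (b - a)) has_field_derivative f' z) (at (of_real t))"
      using ab by (auto intro!: derivative_eq_intros DERIV_chain2[OF f] simp: zS simp flip: z_def)
    then have "((\<lambda>s. f (a + of_real s * (b - a)) / (b - a)) has_vector_derivative f' z) (at t)"
      by (rule has_vector_derivative_real_field)
    then have "(\<phi> has_real_derivative Re (f' z)) (at t)"
      unfolding \<phi>_def has_real_derivative_iff_has_vector_derivative
      by (rule bounded_linear.has_vector_derivative[OF bounded_linear_Re])
    with pos[OF zS] show "\<exists>y. DERIV \<phi> t :> y \<and> y > 0" by blast
  qed simp
  then show False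
    using ab by (simp add: \<phi>_def)
qed

text \<open>
  The function \<open>f = z^p * g\<close> is starlike: the hypothesis says \<open>norm (z * f' z / f z - p) < p\<close>.
  Choose a holomorphic logarithm \<open>L\<close> of \<open>g\<close>. On the left half-plane \<open>p * \<zeta> + L (exp \<zeta>)\<close> is a logarithm of
  \<open>f (exp \<zeta>)\<close>; its derivative has positive real part, so it is injective. It changes by \<open>2 * \<pi> * i * p\<close>
  when \<open>\<zeta>\<close> changes by \<open>2 * \<pi> * i\<close>, and therefore the \<open>p\<close>-th root \<open>F z = z * exp (L z / p)\<close> of \<open>f\<close> is
  injective on the disc. Consequently \<open>F\<close> embeds the solutions of \<open>f z = v\<close> into the \<open>p\<close> roots of
  \<open>w^p = v\<close> when \<open>v \<noteq> 0\<close>, and they are simple zeros because \<open>f'\<close> vanishes at most at 0. The value 0 is taken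
  only at the origin, with multiplicity exactly \<open>p\<close>.
\<close>
lemma starlike_imp_p_valent:
  fixes f g :: "complex \<Rightarrow> complex"
  assumes p: "p \<ge> 1" and g: "g holomorphic_on ball 0 1"
    and star: "\<And>z. z \<in> ball 0 1 \<Longrightarrow> norm (z * deriv g z) < real p * norm (g z)"
    and f: "\<And>z. z \<in> ball 0 1 \<Longrightarrow> f z = z ^ p * g z"
  shows "p_valent p f"
proof -
  have g_nz: "g z \<noteq> 0" if "z \<in> ball 0 1" for z
    using star[OF that] by auto
  obtain L where L: "L holomorphic_on ball 0 1" "\<And>z. z \<in> ball 0 1 \<Longrightarrow> g z = exp (L z)"
    using contractible_imp_holomorphic_log[OF g convex_imp_contractible[OF convex_ball] g_nz] by blast
  have g_deriv: "(g has_field_derivative deriv g z) (at z)" if "z \<in> ball 0 1" for z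
    using g that by (intro holomorphic_derivI[of g "ball 0 1"]) auto
  have L_deriv: "(L has_field_derivative deriv L z) (at z)" if "z \<in> ball 0 1" for z
    using L(1) that by (intro holomorphic_derivI[of L "ball 0 1"]) auto
  have L_bd: "norm (z * deriv L z) < real p" if z: "z \<in> ball 0 1" for z
  proof -
    have "((\<lambda>z. exp (L z)) has_field_derivative g z * deriv L z) (at z)"
      unfolding L(2)[OF z] by (rule derivative_eq_intros L_deriv[OF z] refl)+
    then have "(g has_field_derivative g z * deriv L z) (at z)"
      by (rule has_field_derivative_transform_within_open[of _ _ _ "ball 0 1"])
         (use z L(2) in auto)
    then have "deriv g z = g z * deriv L z"
      by (rule DERIV_imp_deriv)
    then have "norm (g z) * norm (z * deriv L z) < norm (g z) * real p"
      using star[OF z] by (simp add: norm_mult mult_ac)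
    then show ?thesis
      using g_nz[OF z] by simp
  qed
  define F where "F z = z * exp (L z / of_nat p)" for z
  have F_pow: "F z ^ p = f z" if "z \<in> ball 0 1" for z
    using p that by (simp add: F_def f L(2) power_mult_distrib flip: exp_of_nat_mult)
  \<comment> \<open>A logarithm of \<open>f (exp \<zeta>)\<close>, defined on a convex set.\<close>
  have H_inj: "inj_on (\<lambda>\<zeta>. of_nat p * \<zeta> + L (exp \<zeta>)) {\<zeta>. Re \<zeta> < 0}"
  proof (rule inj_on_convex_Re_deriv_pos)
    show "convex {\<zeta>. Re \<zeta> < 0}"
      by (rule convex_halfspace_Re_lt)
    fix \<zeta> assume "\<zeta> \<in> {\<zeta>. Re \<zeta> < 0}"
    then have z: "exp \<zeta> \<in> ball 0 1" by simp
    show "((\<lambda>\<zeta>. of_nat p * \<zeta> + L (exp \<zeta>)) has_field_derivative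
        of_nat p + exp \<zeta> * deriv L (exp \<zeta>)) (at \<zeta>)"
      by (auto intro!: derivative_eq_intros DERIV_chain2[of L _ exp] L_deriv[OF z])
    show "Re (of_nat p + exp \<zeta> * deriv L (exp \<zeta>)) > 0"
      using L_bd[OF z] abs_Re_le_cmod[of "exp \<zeta> * deriv L (exp \<zeta>)"] by simp
  qed
  have F_inj: "inj_on F (ball 0 1)"
  proof (rule inj_onI)
    fix z w assume zw: "z \<in> ball 0 1" "w \<in> ball 0 1" "F z = F w"
    show "z = w"
    proof (cases "z = 0 \<or> w = 0")
      case True
      then show ?thesis using zw by (auto simp: F_def)
    next
      case False
      define \<zeta> \<omega> where "\<zeta> = Ln z" and "\<omega> = Ln w"
      have e: "exp \<zeta> = z" "exp \<omega> = w"
        using False by (simp_all add: \<zeta>_def \<omega>_def)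
      have neg: "Re \<zeta> < 0" "Re \<omega> < 0"
        using zw False by (simp_all add: \<zeta>_def \<omega>_def)
      have "exp (\<zeta> + L z / of_nat p) = exp (\<omega> + L w / of_nat p)"
        using zw by (simp add: exp_add e F_def)
      then obtain k :: int where k:
        "\<zeta> + L z / of_nat p = \<omega> + L w / of_nat p + (of_int (2 * k) * pi) * \<i>"
        by (subst (asm) exp_eq) blast
      \<comment> \<open>The translate of \<open>\<omega>\<close> that makes the logarithms agree exactly.\<close>
      define \<eta> where "\<eta> = \<omega> + (of_int (2 * k) * pi) * \<i>"
      have neg_\<eta>: "Re \<eta> < 0"
        using neg by (simp add: \<eta>_def)
      have ew: "exp \<eta> = w"
      proof -
        have "exp \<eta> = exp \<omega>"
          unfolding \<eta>_def by (rule iffD2[OF exp_eq]) blast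
        then show ?thesis using e(2) by (rule trans)
      qed
      have "\<zeta> + L z / of_nat p = \<eta> + L w / of_nat p"
        using k by (simp add: \<eta>_def)
      then have "of_nat p * (\<zeta> + L z / of_nat p) = of_nat p * (\<eta> + L w / of_nat p)"
        by (rule arg_cong)
      then have "of_nat p * \<zeta> + L z = of_nat p * \<eta> + L w"
        using p by (simp add: distrib_left del: mult_cancel_left)
      then have "of_nat p * \<zeta> + L (exp \<zeta>) = of_nat p * \<eta> + L (exp \<eta>)"
        by (simp only: e(1) ew)
      then have "\<zeta> = \<eta>"
        by (rule inj_onD[OF H_inj]) (simp_all add: neg neg_\<eta>)
      then show ?thesis using ew e by simp
    qed
  qed
  have f_holo: "f holomorphic_on ball 0 1"
  proof -
    have "(\<lambda>z. z ^ p * g z) holomorphic_on ball 0 1"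
      by (intro holomorphic_intros g)
    then show ?thesis
      by (rule holomorphic_transform) (simp add: f)
  qed
  have zorder_simple: "zorder (\<lambda>x. f x - v) z = 1" if z: "z \<in> ball 0 1" "z \<noteq> 0" "f z = v" for z v
  proof (rule zorder_zero_eqI[of _ "ball 0 1"])
    show "(\<lambda>x. f x - v) holomorphic_on ball 0 1"
      by (intro holomorphic_intros f_holo)
    have "((\<lambda>z. z ^ p * g z - v) has_field_derivative
        of_nat p * z ^ (p - 1) * g z + z ^ p * deriv g z) (at z)"
      by (auto intro!: derivative_eq_intros g_deriv z)
    then have "((\<lambda>z. f z - v) has_field_derivative
        of_nat p * z ^ (p - 1) * g z + z ^ p * deriv g z) (at z)"
      by (rule has_field_derivative_transform_within_open[of _ _ _ "ball 0 1"])
         (use z f in auto)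
    then have "deriv (\<lambda>x. f x - v) z = of_nat p * z ^ (p - 1) * g z + z ^ p * deriv g z"
      by (rule DERIV_imp_deriv)
    also have "\<dots> = z ^ (p - 1) * (of_nat p * g z + z * deriv g z)"
      using p by (cases p) (auto simp: algebra_simps)
    also have "\<dots> \<noteq> 0"
    proof -
      have "of_nat p * g z \<noteq> - (z * deriv g z)"
        using star[OF z(1)] by (metis norm_minus_cancel norm_mult norm_of_nat order_less_irrefl)
      then show ?thesis
        using z(2) by (simp add: eq_neg_iff_add_eq_0)
    qed
    finally show "(deriv ^^ nat 1) (\<lambda>x. f x - v) z \<noteq> 0" by simp
  qed (use z in auto)
  have preimages_0: "preimages f 0 = {0}"
    using p g_nz by (auto simp: preimages_def f)
  have "zorder (\<lambda>x. f x - 0) 0 = int p"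
    by (rule zorder_eqI[of "ball 0 1" _ g]) (use g g_nz f in auto)
  then have times_0: "times_taken f 0 = int p"
    by (simp add: times_taken_def preimages_0)
  have bound: "finite (preimages f v) \<and> times_taken f v \<le> int p" if v: "v \<noteq> 0" for v
  proof -
    have card: "card {w. w ^ p = v} = p"
      using v p by (intro card_nth_roots) auto
    have fin: "finite {w. w ^ p = v}"
      using card p by (metis card.infinite not_one_le_zero)
    have inj: "inj_on F (preimages f v)"
      by (rule inj_on_subset[OF F_inj]) (auto simp: preimages_def)
    have sub: "F ` preimages f v \<subseteq> {w. w ^ p = v}"
      using F_pow by (auto simp: preimages_def)
    have "finite (preimages f v)"
      using inj sub fin by (meson finite_imageD finite_subset)
    moreover have "times_taken f v = (\<Sum>z\<in>preimages f v. 1)"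
      unfolding times_taken_def
    proof (rule sum.cong)
      fix z assume "z \<in> preimages f v"
      then show "zorder (\<lambda>x. f x - v) z = 1"
        using v p by (intro zorder_simple) (auto simp: preimages_def f)
    qed simp
    moreover have "card (preimages f v) \<le> p"
      using card_inj_on_le[OF inj sub fin] card by simp
    ultimately show ?thesis by simp
  qed
  have "finite (preimages f v) \<and> times_taken f v \<le> int p" for v
    using bound[of v] times_0 preimages_0 by (cases "v = 0") auto
  then show ?thesis
    using times_0 unfolding p_valent_def by blast
qed

text \<open>
  With \<open>g z = 1 - (\<Sum>i. u i * z^(n+i))\<close> and \<open>T = (\<Sum>i. (n+p+i) * u i)\<close>, one has
  \<open>norm (z * g' z) \<le> norm z * (T - p * (\<Sum>i. u i))\<close> and \<open>norm (g z) \<ge> 1 - norm z * (\<Sum>i. u i)\<close>, so the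
  criterion above asks for \<open>norm z * T < p\<close>.
\<close>
lemma negative_coeffs_p_valent:
  fixes c :: "nat \<Rightarrow> real"
  assumes n: "n \<ge> 1" and p: "p \<ge> 1" and c: "\<And>k. c k \<ge> 0"
    and f: "has_coeffs n p (\<lambda>k. - of_real (c k)) f"
    and s: "summable (\<lambda>i. real (n + p + i) * c (n + p + i))"
    and le: "(\<Sum>i. real (n + p + i) * c (n + p + i)) \<le> real p"
  shows "p_valent p f"
proof -
  define u where "u i = c (n + p + i)" for i
  define T where "T = (\<Sum>i. real (n + p + i) * u i)"
  have u: "u i \<ge> 0" for i
    using c by (simp add: u_def)
  have sT: "summable (\<lambda>i. real (n + p + i) * u i)" and T: "T \<le> real p"
    using s le by (simp_all add: T_def u_def)
  have su: "summable u"
  proof (rule summable_comparison_test'[OF sT])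
    fix i
    have "1 * u i \<le> real (n + p + i) * u i"
      using n u by (intro mult_right_mono) auto
    then show "norm (u i) \<le> real (n + p + i) * u i"
      using u by simp
  qed
  have sv: "summable (\<lambda>i. real (n + i) * u i)" and v: "(\<Sum>i. real (n + i) * u i) = T - real p * suminf u"
  proof -
    have "(\<lambda>i. real (n + p + i) * u i - real p * u i) sums (T - real p * suminf u)"
      unfolding T_def by (intro sums_diff sums_mult summable_sums sT su)
    then have "(\<lambda>i. real (n + i) * u i) sums (T - real p * suminf u)"
      by (simp add: algebra_simps)
    then show "summable (\<lambda>i. real (n + i) * u i)" "(\<Sum>i. real (n + i) * u i) = T - real p * suminf u"
      by (simp_all add: sums_iff)
  qed
  define S :: "complex \<Rightarrow> complex" where "S z = (\<Sum>i. of_real (u i) * z ^ (n + i))" for z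
  have S: "(\<lambda>i. of_real (u i) * z ^ (n + i)) sums S z" if "z \<in> ball 0 1" for z
    unfolding S_def using u su n that by (intro summable_sums dominated_power_series(1)) auto
  have S_holo: "S holomorphic_on ball 0 1"
    by (rule shifted_power_series_holomorphic[OF S])
  show ?thesis
  proof (rule starlike_imp_p_valent[where g = "\<lambda>z. 1 - S z", OF p])
    show "(\<lambda>z. 1 - S z) holomorphic_on ball 0 1"
      by (intro holomorphic_intros S_holo)
  next
    fix z :: complex assume z: "z \<in> ball 0 1"
    have "((\<lambda>z. 1 - S z) has_field_derivative - deriv S z) (at z)"
      using S_holo z by (auto intro!: derivative_eq_intros holomorphic_derivI[of S "ball 0 1"])
    then have "norm (z * deriv (\<lambda>z. 1 - S z) z) = norm (z * deriv S z)"
      by (simp add: DERIV_imp_deriv norm_mult)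
    also have "z * deriv S z = (\<Sum>i. of_real (real (n + i) * u i) * z ^ (n + i))"
      using shifted_power_series_deriv[OF S z] by (simp add: sums_iff)
    also have "norm \<dots> \<le> norm z * (\<Sum>i. real (n + i) * u i)"
      using u sv n z by (intro dominated_power_series(2)) auto
    also have "\<dots> = norm z * (T - real p * suminf u)"
      by (simp only: v)
    also have "\<dots> < real p * (1 - norm z * suminf u)"
    proof -
      have "norm z * T \<le> norm z * real p"
        using T by (intro mult_left_mono) auto
      also have "\<dots> < real p"
        using z p by simp
      finally show ?thesis by (simp add: algebra_simps)
    qed
    also have "\<dots> \<le> real p * norm (1 - S z)"
    proof -
      have "norm (S z) \<le> norm z * suminf u"
        unfolding S_def using u su n z by (intro dominated_power_series(2)) auto
      then have "1 - norm z * suminf u \<le> norm (1 - S z)"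
        using norm_triangle_ineq2[of 1 "S z"] by simp
      then show ?thesis by (intro mult_left_mono) auto
    qed
    finally show "norm (z * deriv (\<lambda>z. 1 - S z) z) < real p * norm (1 - S z)" .
  next
    fix z :: complex assume z: "z \<in> ball 0 1"
    have "(\<lambda>i. - (z ^ p * (of_real (u i) * z ^ (n + i)))) sums - (z ^ p * S z)"
      by (intro sums_minus sums_mult S z)
    moreover have "(\<lambda>i. - (z ^ p * (of_real (u i) * z ^ (n + i)))) =
        (\<lambda>i. - of_real (c (n + p + i)) * z ^ (n + p + i))"
      by (simp add: u_def power_add mult_ac)
    moreover have "(\<lambda>i. - of_real (c (n + p + i)) * z ^ (n + p + i)) sums (f z - z ^ p)"
      using f z by (simp add: has_coeffs_def)
    ultimately have "f z - z ^ p = - (z ^ p * S z)"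
      by (metis sums_unique2)
    then show "f z = z ^ p * (1 - S z)"
      by (simp add: algebra_simps)
  qed
qed

section \<open>Subordination to a Moebius function\<close>

text \<open>
  Solving for \<open>w\<close> gives \<open>w * D = Q\<close> with the real number \<open>D = B - A - B * Q\<close>. This is nonzero, because
  \<open>D = 0\<close> would force \<open>Q = 0\<close> and then \<open>D = B - A\<close>. Hence \<open>\<bar>Q\<bar> < \<bar>D\<bar>\<close>, which for \<open>D > 0\<close> implies the
  claim and for \<open>D < 0\<close> would mean \<open>Q < B * Q - (B - A) < Q\<close>.
\<close>
lemma real_value_of_Moebius_image:
  fixes A B Q :: real and w :: complex
  assumes AB: "A < B" "0 < B" "B \<le> 1" and w: "norm w < 1"
    and eq: "of_real (1 - Q) = (1 + of_real A * w) / (1 + of_real B * w)"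
  shows "(1 + B) * Q < B - A"
proof -
  define D where "D = B - A - B * Q"
  have "norm (of_real B * w) < 1"
  proof -
    have "B * norm w \<le> 1 * norm w"
      using AB by (intro mult_right_mono) auto
    then show ?thesis using w AB by (simp add: norm_mult)
  qed
  then have "1 + of_real B * w \<noteq> 0"
    by (metis add_eq_0_iff norm_minus_cancel norm_one order_less_irrefl)
  then have "of_real (1 - Q) * (1 + of_real B * w) = 1 + of_real A * w"
    using eq by (simp add: divide_simps)
  then have "w * of_real D = of_real Q"
    by (simp add: D_def algebra_simps)
  then have QD: "\<bar>Q\<bar> = norm w * \<bar>D\<bar>"
    by (metis norm_mult norm_of_real)
  have "D \<noteq> 0"
    using QD AB by (auto simp: D_def)
  then have lt: "\<bar>Q\<bar> < \<bar>D\<bar>"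
    using w by (simp add: QD)
  show ?thesis
  proof (cases "D > 0")
    case True
    then show ?thesis using lt by (simp add: D_def algebra_simps)
  next
    case False
    then have "B * Q > 0"
      using AB \<open>D \<noteq> 0\<close> by (simp add: D_def)
    then have "Q > 0"
      using AB by (simp add: zero_less_mult_iff)
    then have "B * Q \<le> 1 * Q"
      using AB by (intro mult_right_mono) auto
    moreover have "Q < B * Q - (B - A)"
      using lt False \<open>Q > 0\<close> by (simp add: D_def)
    ultimately show ?thesis
      using AB by linarith
  qed
qed

text \<open>
  The subordinating function is found by solving \<open>1 - Q = (1 + A * w) / (1 + B * w)\<close> for \<open>w\<close>.
\<close>
lemma subordinate_MoebiusI:
  fixes A B :: real and Q :: "complex \<Rightarrow> complex"
  assumes AB: "A < B" "0 < B" and Q: "Q holomorphic_on ball 0 1" "Q 0 = 0"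
    and bound: "\<And>z. z \<in> ball 0 1 \<Longrightarrow> (1 + B) * norm (Q z) < B - A"
    and F: "\<And>z. z \<in> ball 0 1 \<Longrightarrow> F z = 1 - Q z"
  shows "subordinate F (\<lambda>z. (1 + of_real A * z) / (1 + of_real B * z))"
proof -
  define D where "D z = of_real (B - A) - of_real B * Q z" for z
  have D: "norm (Q z) < norm (D z)" if z: "z \<in> ball 0 1" for z
  proof -
    have "norm (of_real (B - A) :: complex) - norm (of_real B * Q z) \<le> norm (D z)"
      unfolding D_def by (rule norm_triangle_ineq2)
    then show ?thesis
      using bound[OF z] AB by (simp only: norm_mult norm_of_real) (simp add: algebra_simps)
  qed
  then have D_nz: "D z \<noteq> 0" if "z \<in> ball 0 1" for z
    using that by fastforce
  show ?thesis
    unfolding subordinate_def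
  proof (intro exI[of _ "\<lambda>z. Q z / D z"] conjI ballI)
    have "D holomorphic_on ball 0 1"
      unfolding D_def by (intro holomorphic_intros Q)
    then show "(\<lambda>z. Q z / D z) holomorphic_on ball 0 1"
      using D_nz by (intro holomorphic_intros Q) auto
    show "Q 0 / D 0 = 0"
      using Q by simp
    fix z :: complex assume z: "z \<in> ball 0 1"
    show "norm (Q z / D z) < 1"
      using D[OF z] D_nz[OF z] by (simp add: norm_divide)
    have "1 + of_real B * (Q z / D z) = of_real (B - A) / D z"
      using D_nz[OF z] by (simp add: field_simps D_def)
    moreover have "1 + of_real A * (Q z / D z) = of_real (B - A) * (1 - Q z) / D z"
      using D_nz[OF z] by (simp add: field_simps D_def)
    moreover have "of_real (B - A) \<noteq> (0 :: complex)"
      using AB unfolding of_real_eq_0_iff by simp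
    ultimately show "F z = (1 + of_real A * (Q z / D z)) / (1 + of_real B * (Q z / D z))"
      using D_nz[OF z] F[OF z] by (simp del: of_real_diff)
  qed
qed

section \<open>The multiplier operator\<close>

locale multiplier_operator =
  fixes n p :: nat and lam \<mu> l \<delta> :: real
  assumes n: "n \<ge> 1" and p: "p \<ge> 1"
    and \<mu>: "0 \<le> \<mu>" "\<mu> \<le> lam" and l: "0 \<le> l" and \<delta>: "0 \<le> \<delta>"
begin

abbreviation \<Phi> :: "nat \<Rightarrow> real" where
  "\<Phi> \<equiv> Phi p \<delta> lam \<mu> l"

definition \<Phi>_base :: "nat \<Rightarrow> real" where
  "\<Phi>_base k = ((real k - real p) * (lam * \<mu> * real k + lam - \<mu>) + real p + l) / (real p + l)"

lemma Phi_eq: "\<Phi> k = \<Phi>_base k powr \<delta>"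
  by (simp add: Phi_def \<Phi>_base_def)

lemma \<Phi>_base_mono: "\<Phi>_base j \<le> \<Phi>_base k" if "p \<le> j" "j \<le> k"
proof -
  have "(real j - real p) * (lam * \<mu> * real j + lam - \<mu>) \<le>
      (real k - real p) * (lam * \<mu> * real k + lam - \<mu>)"
  proof (rule mult_mono)
    have "lam * \<mu> * real j \<le> lam * \<mu> * real k"
      using that \<mu> by (intro mult_left_mono) auto
    then show "lam * \<mu> * real j + lam - \<mu> \<le> lam * \<mu> * real k + lam - \<mu>" by simp
    have "0 \<le> lam * \<mu> * real j"
      using \<mu> by simp
    then show "0 \<le> lam * \<mu> * real j + lam - \<mu>"
      using \<mu> by linarith
  qed (use that in auto)
  then show ?thesis
    using p l by (simp add: \<Phi>_base_def divide_right_mono)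
qed

text \<open>
  The base is increasing and takes the value 1 at \<open>k = p\<close>.
\<close>
lemma \<Phi>_base_ge_1: "1 \<le> \<Phi>_base k" if "p \<le> k"
  using \<Phi>_base_mono[of p k] that p l by (simp add: \<Phi>_base_def)

lemma Phi_mono: "\<Phi> j \<le> \<Phi> k" if "p \<le> j" "j \<le> k"
  unfolding Phi_eq using that \<Phi>_base_ge_1[of j] \<delta> by (intro powr_mono2 \<Phi>_base_mono) auto

lemma Phi_ge_1: "1 \<le> \<Phi> k" if "p \<le> k"
  unfolding Phi_eq using \<Phi>_base_ge_1[OF that] \<delta> by (rule ge_one_powr_ge_zero)

lemma Phi_moderate: "\<exists>C. \<forall>k\<ge>p. 0 \<le> \<Phi> k \<and> \<Phi> k \<le> C * real k powr (2 * \<delta>)"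
proof (intro exI allI impI conjI)
  fix k assume k: "k \<ge> p"
  define D where "D = (lam * \<mu> + lam + real p + l) / (real p + l)"
  have D: "0 \<le> D"
    using \<mu> l by (simp add: D_def)
  show "0 \<le> \<Phi> k"
    using Phi_ge_1[OF k] by simp
  have k1: "1 \<le> real k"
    using k p by simp
  have "(real k - real p) * (lam * \<mu> * real k + lam - \<mu>) + real p + l \<le>
      real k * ((lam * \<mu> + lam) * real k) + (real p + l) * (real k * real k)"
  proof -
    have "lam \<le> lam * real k"
      using \<mu> k1 by (simp add: mult_le_cancel_left1)
    then have "lam * \<mu> * real k + lam - \<mu> \<le> (lam * \<mu> + lam) * real k"
      using \<mu> by (simp add: algebra_simps)
    moreover have "0 \<le> lam * \<mu> * real k + lam - \<mu>"
      using \<mu> by (simp add: add_nonneg_nonneg add_diff_eq[symmetric])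
    ultimately have "(real k - real p) * (lam * \<mu> * real k + lam - \<mu>) \<le>
        real k * ((lam * \<mu> + lam) * real k)"
      using k by (intro mult_mono) auto
    moreover have "(real p + l) * 1 \<le> (real p + l) * (real k * real k)"
      using k1 l mult_mono[OF k1 k1] by (intro mult_left_mono) auto
    ultimately show ?thesis by simp
  qed
  also have "\<dots> = (lam * \<mu> + lam + real p + l) * real k ^ 2"
    by (simp add: algebra_simps power2_eq_square)
  finally have "\<Phi>_base k \<le> (lam * \<mu> + lam + real p + l) * real k ^ 2 / (real p + l)"
    unfolding \<Phi>_base_def using l by (intro divide_right_mono) auto
  also have "\<dots> = D * real k ^ 2"
    by (simp add: D_def)
  finally have "\<Phi> k \<le> (D * real k ^ 2) powr \<delta>"
    unfolding Phi_eq using \<delta> \<Phi>_base_ge_1[OF k] by (intro powr_mono2) auto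
  also have "\<dots> = D powr \<delta> * (real k ^ 2) powr \<delta>"
    using D by (simp add: powr_mult)
  also have "(real k ^ 2) powr \<delta> = real k powr (2 * \<delta>)"
    using k1 by (simp add: powr_powr flip: powr_numeral)
  finally show "\<Phi> k \<le> D powr \<delta> * real k powr (2 * \<delta>)" .
qed

text \<open>
  The factors \<open>\<Phi> k\<close> grow at most like \<open>k powr (2 * \<delta>)\<close>, so the series that defines \<^const>\<open>J\<close> converges
  on the whole disc and its value there is not a default of \<^const>\<open>suminf\<close>.
\<close>
lemma Phi_series_summable:
  assumes a: "has_coeffs n p a f" and z: "z \<in> ball 0 1"
  shows "summable (\<lambda>i. of_real (\<Phi> (n + p + i)) * a (n + p + i) * z ^ (n + p + i))"
proof -
  obtain C where C: "\<forall>k\<ge>p. 0 \<le> \<Phi> k \<and> \<Phi> k \<le> C * real k powr (2 * \<delta>)"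
    using Phi_moderate by blast
  have "summable (\<lambda>k. a k * w ^ k)" if "w \<in> ball 0 1" for w
    using a that summable_iff_shift[of "\<lambda>k. a k * w ^ k" "n + p"]
    by (auto simp: has_coeffs_def sums_iff add_ac)
  then have "summable (\<lambda>k. of_real (\<Phi> k) * a k * z ^ k)"
    by (rule summable_moderate_multiplier[where K = p]) (use C z in auto)
  then show ?thesis
    using summable_iff_shift[of "\<lambda>k. of_real (\<Phi> k) * a k * z ^ k" "n + p"]
    by (simp add: add_ac)
qed

text \<open>
  Away from 0 the quotient of \<open>(J f)'\<close> by \<open>z^(p-1)\<close> is found by applying the Euler operator and cancelling \<open>z^p\<close>.
  The resulting series is continuous at 0 as well, which identifies the value that
  \<^const>\<open>remove_sings\<close> puts there.
\<close>
lemma J_deriv_quotient_sums: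
  assumes a: "has_coeffs n p a f" and z: "z \<in> ball 0 1"
  shows "(\<lambda>i. of_nat (n + p + i) * (of_real (\<Phi> (n + p + i)) * a (n + p + i)) * z ^ (n + i)) sums
           (remove_sings (\<lambda>x. deriv (J n p \<delta> lam \<mu> l f) x / x ^ (p - 1)) z - of_nat p)"
proof -
  define b where "b i = of_real (\<Phi> (n + p + i)) * a (n + p + i)" for i
  define S where "S x = (\<Sum>i. b i * x ^ (n + p + i))" for x
  define K where "K x = (\<Sum>i. of_nat (n + p + i) * b i * x ^ (n + i))" for x
  have S: "(\<lambda>i. b i * x ^ (n + p + i)) sums S x" if "x \<in> ball 0 1" for x
    unfolding S_def b_def using Phi_series_summable[OF a that] by (rule summable_sums)
  have J_eq: "J n p \<delta> lam \<mu> l f = (\<lambda>x. x ^ p + S x)"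
    by (simp add: fun_eq_iff J_def S_def b_def has_coeffs_imp_fps_nth[OF n a])
  have J_deriv: "deriv (J n p \<delta> lam \<mu> l f) x = of_nat p * x ^ (p - 1) + deriv S x"
    if "x \<in> ball 0 1" for x
  proof -
    have "(S has_field_derivative deriv S x) (at x)"
      using shifted_power_series_holomorphic[OF S] that
      by (intro holomorphic_derivI[of S "ball 0 1"]) auto
    then have "((\<lambda>x. x ^ p + S x) has_field_derivative of_nat p * x ^ (p - 1) + deriv S x) (at x)"
      by (auto intro!: derivative_eq_intros)
    then show ?thesis
      unfolding J_eq by (rule DERIV_imp_deriv)
  qed
  have x_S: "x ^ p * (x ^ (n + i)) = x ^ (n + p + i)" for x :: complex and i
    by (simp add: power_add mult_ac)
  have K: "(\<lambda>i. of_nat (n + p + i) * b i * x ^ (n + i)) sums K x" if x: "x \<in> ball 0 1" for x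
  proof (cases "x = 0")
    case True
    then show ?thesis using n by (simp add: K_def power_0_left)
  next
    case False
    have "summable (\<lambda>i. of_nat (n + p + i) * b i * x ^ (n + p + i) / x ^ p)"
      using shifted_power_series_deriv[OF S x] by (intro summable_divide) (simp add: sums_iff)
    also have "(\<lambda>i. of_nat (n + p + i) * b i * x ^ (n + p + i) / x ^ p) =
        (\<lambda>i. of_nat (n + p + i) * b i * x ^ (n + i))"
      using False by (simp add: mult.assoc flip: x_S)
    finally show ?thesis
      unfolding K_def by (rule summable_sums)
  qed
  have quotient: "of_nat p + K x = deriv (J n p \<delta> lam \<mu> l f) x / x ^ (p - 1)"
    if x: "x \<in> ball 0 1" "x \<noteq> 0" for x
  proof -
    have "(\<lambda>i. x ^ p * (of_nat (n + p + i) * b i * x ^ (n + i))) sums (x ^ p * K x)"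
      by (intro sums_mult K x)
    then have "(\<lambda>i. of_nat (n + p + i) * b i * x ^ (n + p + i)) sums (x ^ p * K x)"
      by (simp add: mult.left_commute flip: x_S)
    with shifted_power_series_deriv[OF S x(1)] have "x * deriv S x = x ^ p * K x"
      by (rule sums_unique2)
    also have "\<dots> = x * (x ^ (p - 1) * K x)"
      using p by (cases p) auto
    finally have "deriv S x = x ^ (p - 1) * K x"
      using x by simp
    then show ?thesis
      using x by (simp add: J_deriv field_simps)
  qed
  have "remove_sings (\<lambda>x. deriv (J n p \<delta> lam \<mu> l f) x / x ^ (p - 1)) z = of_nat p + K z"
  proof (rule remove_sings_eqI, rule Lim_transform_eventually)
    have "K holomorphic_on ball 0 1"
      by (rule shifted_power_series_holomorphic[OF K])
    then have "isCont (\<lambda>x. of_nat p + K x) z"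
      using z by (intro continuous_intros continuous_on_interior[of "ball 0 1"]
          holomorphic_on_imp_continuous_on) auto
    then show "(\<lambda>x. of_nat p + K x) \<midarrow>z\<rightarrow> of_nat p + K z"
      by (simp add: isCont_def)
    have "\<forall>\<^sub>F x in at z. x \<in> ball 0 1"
      using z by (intro eventually_at_in_open') auto
    moreover have "\<forall>\<^sub>F x in at z. x \<noteq> 0"
      by (rule eventually_neq_at_within)
    ultimately show "\<forall>\<^sub>F x in at z. of_nat p + K x = deriv (J n p \<delta> lam \<mu> l f) x / x ^ (p - 1)"
      by eventually_elim (rule quotient)
  qed
  then show ?thesis
    using K[OF z] by (simp add: b_def)
qed

end

section \<open>The coefficient characterization\<close>

locale Janowski_class = multiplier_operator +
  fixes A B :: real
  assumes A: "-1 \<le> A" and AB: "A < B" and B: "0 < B" "B \<le> 1"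
begin

text \<open>
  A summand \<open>c * z^k\<close> of \<open>f\<close> contributes \<open>weight k * c * z^(k-p)\<close> to the quotient of \<open>(J f)'\<close> by
  \<open>z^(p-1)\<close>.
\<close>
definition weight :: "nat \<Rightarrow> real" where
  "weight k = real k * \<Phi> k"

lemma weight_nonneg: "0 \<le> weight (n + p + i)"
  using Phi_ge_1[of "n + p + i"] by (simp add: weight_def)

lemma weight_ge_index: "real (n + p + i) \<le> weight (n + p + i)"
  using Phi_ge_1[of "n + p + i"] mult_left_mono[of 1 "\<Phi> (n + p + i)" "real (n + p + i)"]
  by (simp add: weight_def)

lemma weight_mono: "weight (n + p) \<le> weight (n + p + i)"
  using Phi_mono[of "n + p" "n + p + i"] Phi_ge_1[of "n + p"]
  unfolding weight_def by (intro mult_mono) auto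

lemma weight_pos: "0 < weight (n + p)"
  using weight_ge_index[of 0] p by simp

text \<open>
  At a point \<open>r\<close> of the positive radius the subordinate function takes the real value
  \<open>1 - T / (p - \<sigma>)\<close> with \<open>T = (\<Sum>i. w i * r^(n+i))\<close>. This bounds \<open>T\<close>, and \<open>r\<close> may tend to 1.
\<close>
lemma class_P_neg_imp_coeff_bound:
  assumes c: "\<And>k. c k \<ge> 0" and f: "has_coeffs n p (\<lambda>k. - of_real (c k)) f"
    and \<sigma>: "\<sigma> < real p" and mem: "f \<in> class_P_neg n p \<delta> lam \<mu> l A B \<sigma>"
  shows "summable (\<lambda>i. weight (n + p + i) * c (n + p + i))"
    and "(\<Sum>i. weight (n + p + i) * c (n + p + i)) \<le> (B - A) * (real p - \<sigma>) / (1 + B)"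
proof -
  define R where "R = remove_sings (\<lambda>x. deriv (J n p \<delta> lam \<mu> l f) x / x ^ (p - 1))"
  define w where "w i = weight (n + p + i) * c (n + p + i)" for i
  have w: "w i \<ge> 0" for i
    using weight_nonneg c by (simp add: w_def)
  have "(\<Sum>i<N. w i * r ^ (n + i)) \<le> (B - A) * (real p - \<sigma>) / (1 + B)" if r: "0 < r" "r < 1" for r N
  proof -
    have rb: "(of_real r :: complex) \<in> ball 0 1"
      using r by simp
    have "(\<lambda>i. - (of_nat (n + p + i) * (of_real (\<Phi> (n + p + i)) * - of_real (c (n + p + i))) *
        of_real r ^ (n + i))) sums - (R (of_real r) - of_nat p)"
      unfolding R_def by (intro sums_minus J_deriv_quotient_sums[OF f] rb)
    then have sums: "(\<lambda>i. of_real (w i * r ^ (n + i))) sums (of_nat p - R (of_real r))"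
      by (simp add: w_def weight_def mult_ac)
    then have summ: "summable (\<lambda>i. w i * r ^ (n + i))"
      using summable_complex_of_real[of "\<lambda>i. w i * r ^ (n + i)"] by (simp only: sums_iff)
    define T where "T = (\<Sum>i. w i * r ^ (n + i))"
    have "of_nat p - R (of_real r) = of_real T"
      using sums_unique2[OF sums sums_of_real[OF summable_sums[OF summ]]] by (simp add: T_def)
    then have R: "R (of_real r) = of_real (real p - T)"
      by (simp add: algebra_simps)
    obtain \<omega> :: "complex \<Rightarrow> complex" where \<omega>: "norm (\<omega> (of_real r)) < 1"
      "1 / of_real (real p - \<sigma>) * (R (of_real r) - of_real \<sigma>) =
        (1 + of_real A * \<omega> (of_real r)) / (1 + of_real B * \<omega> (of_real r))"
      using mem rb unfolding class_P_neg_def class_P_def subordinate_def R_def by blast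
    have "1 / of_real (real p - \<sigma>) * (R (of_real r) - of_real \<sigma>) =
        (of_real (1 / (real p - \<sigma>) * ((real p - T) - \<sigma>)) :: complex)"
      by (simp add: R)
    also have "1 / (real p - \<sigma>) * ((real p - T) - \<sigma>) = 1 - T / (real p - \<sigma>)"
      using \<sigma> by (simp add: field_simps)
    finally have "of_real (1 - T / (real p - \<sigma>)) =
        (1 + of_real A * \<omega> (of_real r)) / (1 + of_real B * \<omega> (of_real r))"
      using \<omega>(2) by simp
    then have "(1 + B) * (T / (real p - \<sigma>)) < B - A"
      by (rule real_value_of_Moebius_image[OF AB B \<omega>(1)])
    then have "T \<le> (B - A) * (real p - \<sigma>) / (1 + B)"
      using \<sigma> B by (simp add: field_simps)
    moreover have "(\<Sum>i<N. w i * r ^ (n + i)) \<le> T"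
      unfolding T_def using w r by (intro sum_le_suminf summ) auto
    ultimately show ?thesis by simp
  qed
  then show "summable (\<lambda>i. weight (n + p + i) * c (n + p + i))"
    and "(\<Sum>i. weight (n + p + i) * c (n + p + i)) \<le> (B - A) * (real p - \<sigma>) / (1 + B)"
    unfolding w_def[symmetric]
    using nonneg_summable_at_1[of w n, OF w] by blast+
qed

text \<open>
  Both requirements come from the same inequality: since \<open>weight k \<ge> k\<close> and \<open>B - A \<le> 1 + B\<close>, it bounds
  \<open>(\<Sum>k. k * c k)\<close> by \<open>p\<close>, which gives \<open>p\<close>-valence, and the triangle inequality gives
  \<open>(1 + B) * norm (Q z) < B - A\<close>, which gives the subordination.
\<close>
lemma class_P_negI:
  assumes c: "\<And>k. c k \<ge> 0" and f: "has_coeffs n p (\<lambda>k. - of_real (c k)) f"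
    and \<sigma>: "0 \<le> \<sigma>" "\<sigma> < real p"
    and summ: "summable (\<lambda>i. weight (n + p + i) * c (n + p + i))"
    and le: "(\<Sum>i. weight (n + p + i) * c (n + p + i)) \<le> (B - A) * (real p - \<sigma>) / (1 + B)"
  shows "f \<in> class_P_neg n p \<delta> lam \<mu> l A B \<sigma>"
proof -
  define R where "R = remove_sings (\<lambda>x. deriv (J n p \<delta> lam \<mu> l f) x / x ^ (p - 1))"
  define w where "w i = weight (n + p + i) * c (n + p + i)" for i
  have w: "w i \<ge> 0" for i
    using weight_nonneg c by (simp add: w_def)
  have sw: "summable w" and wle: "(1 + B) * suminf w \<le> (B - A) * (real p - \<sigma>)"
    using summ le B unfolding w_def[symmetric] by (simp_all add: pos_le_divide_eq mult.commute)
  have "p_valent p f"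
  proof (rule negative_coeffs_p_valent[OF n p c f])
    have bd: "real (n + p + i) * c (n + p + i) \<le> w i" for i
      unfolding w_def using weight_ge_index c by (intro mult_right_mono)
    show s: "summable (\<lambda>i. real (n + p + i) * c (n + p + i))"
      by (rule summable_comparison_test'[OF sw]) (use bd c in simp)
    have "(1 + B) * suminf w \<le> (1 + B) * (real p - \<sigma>)"
      using wle A \<sigma> mult_right_mono[of "B - A" "1 + B" "real p - \<sigma>"] by linarith
    then have "suminf w \<le> real p"
      using B \<sigma> by simp
    with suminf_le[OF bd s sw] show "(\<Sum>i. real (n + p + i) * c (n + p + i)) \<le> real p"
      by simp
  qed
  then have f_class: "f \<in> class_A n p"
    using f has_coeffs_holomorphic[OF f] unfolding class_A_def by blast
  define u where "u i = w i / (real p - \<sigma>)" for i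
  define Q :: "complex \<Rightarrow> complex" where "Q z = (\<Sum>i. of_real (u i) * z ^ (n + i))" for z
  have u: "u i \<ge> 0" "summable u" for i
    unfolding u_def using w sw \<sigma> by (simp_all add: summable_divide)
  have u_sum: "(1 + B) * suminf u \<le> B - A"
  proof -
    have "suminf u = suminf w / (real p - \<sigma>)"
      unfolding u_def by (rule suminf_divide[OF sw])
    then show ?thesis
      using wle \<sigma> by (simp add: pos_divide_le_eq)
  qed
  have Q: "(\<lambda>i. of_real (u i) * z ^ (n + i)) sums Q z" if "z \<in> ball 0 1" for z
    unfolding Q_def using u n that by (intro summable_sums dominated_power_series(1)) auto
  have "subordinate (\<lambda>z. 1 / of_real (real p - \<sigma>) * (R z - of_real \<sigma>))
          (\<lambda>z. (1 + of_real A * z) / (1 + of_real B * z))"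
  proof (rule subordinate_MoebiusI[OF AB B(1)])
    show "Q holomorphic_on ball 0 1"
      by (rule shifted_power_series_holomorphic[OF Q])
    show "Q 0 = 0"
      using n by (simp add: Q_def power_0_left)
    fix z :: complex assume z: "z \<in> ball 0 1"
    have "norm (Q z) \<le> norm z * suminf u"
      unfolding Q_def using u n z by (intro dominated_power_series(2)) auto
    then have "(1 + B) * norm (Q z) \<le> (1 + B) * (norm z * suminf u)"
      using B by (intro mult_left_mono) auto
    also have "\<dots> = norm z * ((1 + B) * suminf u)"
      by simp
    also have "\<dots> \<le> norm z * (B - A)"
      using u_sum by (intro mult_left_mono) auto
    also have "\<dots> < B - A"
      using z AB by simp
    finally show "(1 + B) * norm (Q z) < B - A" .
    have "(\<lambda>i. of_real (real p - \<sigma>) * (of_real (u i) * z ^ (n + i))) sums (of_real (real p - \<sigma>) * Q z)"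
      by (intro sums_mult Q z)
    moreover have "of_real (real p - \<sigma>) * (of_real (u i) * z ^ (n + i)) =
        - (of_nat (n + p + i) * (of_real (\<Phi> (n + p + i)) * - of_real (c (n + p + i))) * z ^ (n + i))"
      for i
    proof -
      have "(real p - \<sigma>) * u i = w i"
        using \<sigma> by (simp add: u_def)
      then have "of_real (real p - \<sigma>) * (of_real (u i) :: complex) = of_real (w i)"
        by (metis of_real_mult)
      then show ?thesis
        by (simp only: mult.assoc[symmetric]) (simp add: w_def weight_def mult_ac)
    qed
    ultimately have "of_real (real p - \<sigma>) * Q z = - (R z - of_nat p)"
      using sums_minus[OF J_deriv_quotient_sums[OF f z]] unfolding R_def
      by (simp only:) (rule sums_unique2)
    then have "R z = of_real (real p) - of_real (real p - \<sigma>) * Q z"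
      by (simp add: algebra_simps)
    moreover have "of_real (real p - \<sigma>) \<noteq> (0 :: complex)"
      using \<sigma> unfolding of_real_eq_0_iff by simp
    ultimately show "1 / of_real (real p - \<sigma>) * (R z - of_real \<sigma>) = 1 - Q z"
      by (simp add: field_simps)
  qed
  then have "f \<in> class_P n p \<delta> lam \<mu> l A B \<sigma>"
    using f_class unfolding class_P_def R_def by simp
  moreover have "has_coeffs n p (\<lambda>k. - of_real (norm (of_real (c k) :: complex))) f"
    using f c by simp
  ultimately show ?thesis
    unfolding class_P_neg_def by (intro CollectI conjI exI[of _ "\<lambda>k. of_real (c k)"])
qed

text \<open>
  For a single coefficient the characterization is one numerical inequality; it shows that the extremal functions belong
  to the class and that the order of their sum of squares cannot be raised.
\<close>
lemma two_term_in_class_P_neg_iff: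
  assumes e: "e \<ge> 0" and \<sigma>: "0 \<le> \<sigma>" "\<sigma> < real p"
  shows "(\<lambda>z. z ^ p - of_real e * z ^ (n + p)) \<in> class_P_neg n p \<delta> lam \<mu> l A B \<sigma> \<longleftrightarrow>
           weight (n + p) * e \<le> (B - A) * (real p - \<sigma>) / (1 + B)"
    (is "?f \<in> _ \<longleftrightarrow> _")
proof -
  define c where "c k = (if k = n + p then e else 0)" for k
  have c: "c k \<ge> 0" for k
    using e by (simp add: c_def)
  have f: "has_coeffs n p (\<lambda>k. - of_real (c k)) ?f"
    unfolding has_coeffs_def
  proof
    fix z :: complex
    have "(\<lambda>i. if i = 0 then - (of_real e * z ^ (n + p)) else 0) sums - (of_real e * z ^ (n + p))"
      using sums_single[of 0 "\<lambda>_. - (of_real e * z ^ (n + p))"] by simp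
    also have "(\<lambda>i. if i = 0 then - (of_real e * z ^ (n + p)) else 0) =
        (\<lambda>i. - of_real (c (n + p + i)) * z ^ (n + p + i))"
      by (auto simp: c_def)
    finally show "(\<lambda>i. - of_real (c (n + p + i)) * z ^ (n + p + i)) sums (?f z - z ^ p)"
      by simp
  qed
  have "(\<lambda>i. if i = 0 then weight (n + p) * e else 0) sums (weight (n + p) * e)"
    using sums_single[of 0 "\<lambda>_. weight (n + p) * e"] by simp
  also have "(\<lambda>i. if i = 0 then weight (n + p) * e else 0) =
      (\<lambda>i. weight (n + p + i) * c (n + p + i))"
    by (auto simp: c_def)
  finally have s: "summable (\<lambda>i. weight (n + p + i) * c (n + p + i))"
    "(\<Sum>i. weight (n + p + i) * c (n + p + i)) = weight (n + p) * e"
    by (simp_all add: sums_iff)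
  show ?thesis
    using class_P_neg_imp_coeff_bound(2)[OF c f \<sigma>(2)] class_P_negI[OF c f \<sigma>] s by auto
qed

end

section \<open>Sums of squares of coefficients\<close>

text \<open>
  Each summand \<open>q i * c i\<close> is at most \<open>M\<close>, so \<open>c i \<le> M / q0\<close>, and one factor of the square can be
  estimated in this way.
\<close>
lemma weighted_square_sum_le:
  fixes q c :: "nat \<Rightarrow> real"
  assumes q: "\<And>i. q0 \<le> q i" "0 < q0" and c: "\<And>i. c i \<ge> 0"
    and s: "summable (\<lambda>i. q i * c i)" and le: "(\<Sum>i. q i * c i) \<le> M"
  shows "summable (\<lambda>i. q i * (c i)\<^sup>2)" and "(\<Sum>i. q i * (c i)\<^sup>2) \<le> M\<^sup>2 / q0"
proof -
  have nonneg: "0 \<le> q i * c i" for i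
    using q(1)[of i] q(2) c[of i] by simp
  have M: "0 \<le> M"
    using suminf_nonneg[OF s nonneg] le by simp
  have term_le: "q i * c i \<le> M" for i
    using sum_le_suminf[OF s, of "{i}"] nonneg le by simp
  have bd: "q i * (c i)\<^sup>2 \<le> M / q0 * (q i * c i)" for i
  proof -
    have "q0 * c i \<le> M"
      using mult_right_mono[OF q(1)[of i] c[of i]] term_le[of i] by linarith
    then have "c i \<le> M / q0"
      using q(2) by (simp add: field_simps)
    then have "c i * (q i * c i) \<le> M / q0 * (q i * c i)"
      by (intro mult_right_mono nonneg)
    then show ?thesis by (simp add: power2_eq_square mult_ac)
  qed
  have sM: "summable (\<lambda>i. M / q0 * (q i * c i))"
    by (intro summable_mult s)
  show s2: "summable (\<lambda>i. q i * (c i)\<^sup>2)"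
  proof (rule summable_comparison_test'[OF sM])
    fix i
    show "norm (q i * (c i)\<^sup>2) \<le> M / q0 * (q i * c i)"
      using bd[of i] q(1)[of i] q(2) by simp
  qed
  have "(\<Sum>i. q i * (c i)\<^sup>2) \<le> (\<Sum>i. M / q0 * (q i * c i))"
    by (rule suminf_le[OF bd s2 sM])
  also have "\<dots> = M / q0 * (\<Sum>i. q i * c i)"
    by (rule suminf_mult[OF s])
  also have "\<dots> \<le> M / q0 * M"
    using M q le by (intro mult_left_mono) auto
  finally show "(\<Sum>i. q i * (c i)\<^sup>2) \<le> M\<^sup>2 / q0"
    by (simp add: power2_eq_square)
qed

context Janowski_class
begin

text \<open>
  Every function of the family satisfies the coefficient inequality with the common bound \<open>M\<close>, since
  \<open>\<sigma>s \<le> \<sigma> j\<close>. The weighted sums of squares are then at most \<open>M\<^sup>2 / weight (n + p)\<close> each, and the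
  last hypothesis says that \<open>m\<close> times this value is exactly what the order \<open>chi\<close> admits.
\<close>
lemma square_sum_fun_in_class_P_neg:
  assumes \<sigma>: "\<And>j. j \<in> {1..m} \<Longrightarrow> \<sigma>s \<le> \<sigma> j \<and> \<sigma> j < real p"
    and f: "\<And>j. j \<in> {1..m} \<Longrightarrow> has_coeffs n p (\<lambda>k. - of_real (norm (a k j))) (f j)"
    and mem: "\<And>j. j \<in> {1..m} \<Longrightarrow> f j \<in> class_P_neg n p \<delta> lam \<mu> l A B (\<sigma> j)"
    and chi: "0 \<le> chi" "chi < real p"
      "real m * ((B - A) * (real p - \<sigma>s) / (1 + B))\<^sup>2 / weight (n + p) = (B - A) * (real p - chi) / (1 + B)"
  shows "square_sum_fun n p m a \<in> class_P_neg n p \<delta> lam \<mu> l A B chi"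
proof -
  define M where "M = (B - A) * (real p - \<sigma>s) / (1 + B)"
  define d where "d k = (\<Sum>j=1..m. (norm (a k j))\<^sup>2)" for k
  define q where "q i = weight (n + p + i)" for i
  have d: "d k \<ge> 0" for k
    by (simp add: d_def sum_nonneg)
  have q: "weight (n + p) \<le> q i" "1 \<le> q i" for i
    using weight_mono[of i] weight_ge_index[of i] n by (simp_all add: q_def)
  have sq: "summable (\<lambda>i. q i * (norm (a (n + p + i) j))\<^sup>2)"
      "(\<Sum>i. q i * (norm (a (n + p + i) j))\<^sup>2) \<le> M\<^sup>2 / weight (n + p)" if j: "j \<in> {1..m}" for j
  proof -
    have "\<sigma> j < real p"
      using \<sigma>[OF j] by simp
    note bound = class_P_neg_imp_coeff_bound[OF norm_ge_zero f[OF j] this mem[OF j], folded q_def]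
    have "(\<Sum>i. q i * norm (a (n + p + i) j)) \<le> M"
    proof (rule order_trans[OF bound(2)])
      show "(B - A) * (real p - \<sigma> j) / (1 + B) \<le> M"
        unfolding M_def using \<sigma>[OF j] AB B by (intro divide_right_mono mult_left_mono) auto
    qed
    from weighted_square_sum_le[OF q(1) weight_pos norm_ge_zero bound(1) this]
    show "summable (\<lambda>i. q i * (norm (a (n + p + i) j))\<^sup>2)"
      "(\<Sum>i. q i * (norm (a (n + p + i) j))\<^sup>2) \<le> M\<^sup>2 / weight (n + p)" .
  qed
  have qd: "q i * d (n + p + i) = (\<Sum>j=1..m. q i * (norm (a (n + p + i) j))\<^sup>2)" for i
    by (simp add: d_def sum_distrib_left)
  have s_qd: "summable (\<lambda>i. q i * d (n + p + i))"
    unfolding qd by (intro summable_sum sq)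
  have "(\<Sum>i. q i * d (n + p + i)) = (\<Sum>j=1..m. \<Sum>i. q i * (norm (a (n + p + i) j))\<^sup>2)"
    unfolding qd by (intro suminf_sum sq)
  also have "\<dots> \<le> (\<Sum>j=1..m. M\<^sup>2 / weight (n + p))"
    by (intro sum_mono sq)
  also have "\<dots> = (B - A) * (real p - chi) / (1 + B)"
    using chi(3) by (simp add: M_def)
  finally have le: "(\<Sum>i. q i * d (n + p + i)) \<le> (B - A) * (real p - chi) / (1 + B)" .
  have "summable (\<lambda>i. d (n + p + i))"
  proof (rule summable_comparison_test'[OF s_qd])
    fix i
    show "norm (d (n + p + i)) \<le> q i * d (n + p + i)"
      using mult_right_mono[OF q(2)[of i] d[of "n + p + i"]] d[of "n + p + i"] by simp
  qed
  then have "has_coeffs n p (\<lambda>k. - of_real (d k)) (square_sum_fun n p m a)"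
    using has_coeffs_of_summable[of n d p, OF n d] unfolding square_sum_fun_def d_def by simp
  from class_P_negI[OF d this chi(1,2)] s_qd le show ?thesis
    by (simp add: q_def)
qed

text \<open>
  The extremal coefficient is the value at which the coefficient inequality becomes an equality.
\<close>
lemma weight_extremal_coeff:
  "weight (n + p) * extremal_coeff n p \<delta> lam \<mu> l A B \<sigma> = (B - A) * (real p - \<sigma>) / (1 + B)"
proof -
  have "extremal_coeff n p \<delta> lam \<mu> l A B \<sigma> = (B - A) * (real p - \<sigma>) / ((1 + B) * weight (n + p))"
    by (simp add: extremal_coeff_def weight_def mult_ac)
  then show ?thesis
    using weight_pos by simp
qed

end

theorem theorem6p2:
  fixes n p m :: nat and lam \<mu> l \<delta> A B chi \<sigma>s :: real and \<sigma> :: "nat \<Rightarrow> real"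
  assumes "n \<ge> 1" and "p \<ge> 1" and "m \<ge> 1"
    and "\<mu> \<ge> 0" and "lam \<ge> \<mu>" and "l \<ge> 0" and "\<delta> \<ge> 0"
    and "-1 \<le> A" and "A < B" and "B \<le> 1" and "0 < B"
    and "\<forall>j\<in>{1..m}. 0 \<le> \<sigma> j \<and> \<sigma> j < real p"
    and "\<sigma>s = Min (\<sigma> ` {1..m})"
    and "chi = real p - real m * (B - A) * (real p - \<sigma>s)\<^sup>2 /
                     (real (n + p) * (1 + B) * Phi p \<delta> lam \<mu> l (n + p))"
    and "chi \<ge> 0"
  shows
    "(\<forall>(f :: nat \<Rightarrow> complex \<Rightarrow> complex) (a :: nat \<Rightarrow> nat \<Rightarrow> complex).
        (\<forall>j\<in>{1..m}. has_coeffs n p (\<lambda>k. - of_real (norm (a k j))) (f j) \<and>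
                     f j \<in> class_P_neg n p \<delta> lam \<mu> l A B (\<sigma> j)) \<longrightarrow>
        square_sum_fun n p m a \<in> class_P_neg n p \<delta> lam \<mu> l A B chi) \<and>
     (\<forall>j\<in>{1..m}.
        (\<lambda>z. z ^ p - of_real (extremal_coeff n p \<delta> lam \<mu> l A B (\<sigma> j)) * z ^ (p + n))
          \<in> class_P_neg n p \<delta> lam \<mu> l A B (\<sigma> j)) \<and>
     ((\<forall>j\<in>{1..m}. \<sigma> j = \<sigma>s) \<longrightarrow>
        (\<forall>chi'. chi < chi' \<and> chi' < real p \<longrightarrow>
           square_sum_fun n p m
             (\<lambda>k j. if k = n + p then of_real (extremal_coeff n p \<delta> lam \<mu> l A B (\<sigma> j)) else 0)
             \<notin> class_P_neg n p \<delta> lam \<mu> l A B chi'))"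
proof -
  interpret Janowski_class n p lam \<mu> l \<delta> A B
    using assms by unfold_locales auto
  let ?e = "extremal_coeff n p \<delta> lam \<mu> l A B"
  have \<sigma>: "\<sigma>s \<le> \<sigma> j" "0 \<le> \<sigma> j" "\<sigma> j < real p" if "j \<in> {1..m}" for j
    using that assms(12,13) by auto
  have \<sigma>s: "\<sigma>s < real p"
    using \<sigma>[of 1] \<open>m \<ge> 1\<close> by simp
  have \<Phi>_pos: "0 < \<Phi> (n + p)"
    using Phi_ge_1[of "n + p"] by simp
  have chi_eq: "real p - chi = real m * (B - A) * (real p - \<sigma>s)\<^sup>2 / ((1 + B) * weight (n + p))"
    using assms(14) by (simp add: weight_def mult_ac)
  have "0 < real m * (B - A) * (real p - \<sigma>s)\<^sup>2 / ((1 + B) * weight (n + p))"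
    using \<open>m \<ge> 1\<close> AB B \<sigma>s weight_pos by simp
  then have chi_less: "chi < real p"
    using chi_eq by simp
  have chi_id: "real m * ((B - A) * (real p - \<sigma>s) / (1 + B))\<^sup>2 / weight (n + p) =
      (B - A) * (real p - chi) / (1 + B)"
    unfolding chi_eq using B by (simp add: power2_eq_square mult_ac)
  have "square_sum_fun n p m a \<in> class_P_neg n p \<delta> lam \<mu> l A B chi"
    if "\<forall>j\<in>{1..m}. has_coeffs n p (\<lambda>k. - of_real (norm (a k j))) (f j) \<and>
          f j \<in> class_P_neg n p \<delta> lam \<mu> l A B (\<sigma> j)" for f and a :: "nat \<Rightarrow> nat \<Rightarrow> complex"
    by (rule square_sum_fun_in_class_P_neg[of m \<sigma>s \<sigma> a f])
       (use that \<sigma> chi_id chi_less \<open>chi \<ge> 0\<close> in auto)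
  moreover have "(\<lambda>z. z ^ p - of_real (?e (\<sigma> j)) * z ^ (p + n))
      \<in> class_P_neg n p \<delta> lam \<mu> l A B (\<sigma> j)" if j: "j \<in> {1..m}" for j
  proof -
    have "0 \<le> ?e (\<sigma> j)"
      using \<sigma>[OF j] AB B \<Phi>_pos by (simp add: extremal_coeff_def)
    then show ?thesis
      using two_term_in_class_P_neg_iff[of "?e (\<sigma> j)" "\<sigma> j"] \<sigma>[OF j] weight_extremal_coeff[of "\<sigma> j"]
      by (simp add: add.commute)
  qed
  moreover have "square_sum_fun n p m (\<lambda>k j. if k = n + p then of_real (?e (\<sigma> j)) else 0)
      \<notin> class_P_neg n p \<delta> lam \<mu> l A B chi'"
    if eq: "\<forall>j\<in>{1..m}. \<sigma> j = \<sigma>s" and chi': "chi < chi'" "chi' < real p" for chi'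
  proof
    assume mem: "square_sum_fun n p m (\<lambda>k j. if k = n + p then of_real (?e (\<sigma> j)) else 0)
      \<in> class_P_neg n p \<delta> lam \<mu> l A B chi'"
    \<comment> \<open>The functions coincide, so only one coefficient of the sum of squares is left.\<close>
    define E where "E = real m * (?e \<sigma>s)\<^sup>2"
    have "square_sum_fun n p m (\<lambda>k j. if k = n + p then of_real (?e (\<sigma> j)) else 0) =
        (\<lambda>z. z ^ p - of_real E * z ^ (n + p))"
    proof
      fix z :: complex
      have "(\<Sum>j=1..m. (norm (if n + p + i = n + p then of_real (?e (\<sigma> j)) else 0 :: complex))\<^sup>2) =
          (if i = 0 then E else 0)" for i
        using eq by (simp add: E_def)
      then have "square_sum_fun n p m (\<lambda>k j. if k = n + p then of_real (?e (\<sigma> j)) else 0) z =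
          z ^ p - (\<Sum>i. of_real (if i = 0 then E else 0) * z ^ (n + p + i))"
        unfolding square_sum_fun_def by simp
      also have "(\<lambda>i. of_real (if i = 0 then E else 0) * z ^ (n + p + i)) =
          (\<lambda>i. if i = 0 then of_real E * z ^ (n + p) else 0)"
        by auto
      also have "(\<Sum>i. if i = 0 then of_real E * z ^ (n + p) else 0) = of_real E * z ^ (n + p)"
        using sums_single[of 0 "\<lambda>_. of_real E * z ^ (n + p)"] by (simp add: sums_iff)
      finally show "square_sum_fun n p m (\<lambda>k j. if k = n + p then of_real (?e (\<sigma> j)) else 0) z =
          z ^ p - of_real E * z ^ (n + p)" .
    qed
    then have "weight (n + p) * E \<le> (B - A) * (real p - chi') / (1 + B)"
      using mem two_term_in_class_P_neg_iff[of E chi'] chi' \<open>chi \<ge> 0\<close> by (simp add: E_def)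
    moreover have "weight (n + p) * E = (B - A) * (real p - chi) / (1 + B)"
    proof -
      have "weight (n + p) * E = real m * (weight (n + p) * ?e \<sigma>s)\<^sup>2 / weight (n + p)"
        using weight_pos by (simp add: E_def power2_eq_square)
      then show ?thesis
        by (simp only: weight_extremal_coeff chi_id)
    qed
    moreover have "(B - A) * (real p - chi') / (1 + B) < (B - A) * (real p - chi) / (1 + B)"
      using chi' AB B by (intro divide_strict_right_mono mult_strict_left_mono) auto
    ultimately show False by simp
  qed
  ultimately show ?thesis by blast
qed

end
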